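(* Let $A$ be an involutive semiring (equivalently, an involutive residuated lattice), and let $0=-1$. Then the interval $[0,1]=\{a\in A\mid 0\le a\le 1\}$ is a subalgebra of $A$ if and only if $0$ is multiplicatively idempotent, i.e., $0\cdot 0=0$.
   Context: An involutive semiring is an algebra $(A,\vee,\cdot,1,{\sim},-)$ such that $(A,\vee)$ is a join-semilattice (with order $x\le y\iff x\vee y=y$), $(A,\cdot,1)$ is a monoid, $\cdot$ distributes over $\vee$ from both sides, and the unary operations ${\sim},-$ satisfy, for all $x,y\in A$, $x\le y\iff x\cdot{\sim}y\le -1\iff -y\cdot x\le -1$. The element $-1$ is denoted $0$; it need not be the least element of $A$. Involutive semirings are term-equivalent to involutive residuated lattices, i.e. algebras $(A,\vee,\wedge,\cdot,1,\backslash,/,0)$ such that $(A,\vee,\wedge)$ is a lattice, $(A,\cdot,1)$ is a monoid, $xy\le z\iff x\le z/y\iff y\le x\backslash z$, and ${\sim}{-}x=x=-{\sim}x$ where ${\sim}x=x\backslash 0$, $-x=0/x$; under this equivalence $x\backslash y={\sim}((-y)x)$, $x/y=-(y({\sim}x))$, $0=-1={\sim}1$ and $x\wedge y={\sim}(-x\vee -y)$. A subalgebra is a subset closed under all operations of the algebra, including the constants (in particular it contains $1$). *)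

theory Defs
  imports Main
begin

class involutive_semiring = semilattice_sup + monoid_mult + uminus +
  fixes tilde :: "'a \<Rightarrow> 'a"  (\<open>\<sim> _\<close> [81] 80)
  assumes mult_sup_distrib_left: "x * sup y z = sup (x * y) (x * z)"
    and mult_sup_distrib_right: "sup x y * z = sup (x * z) (y * z)"
    and le_iff_mult_tilde: "x \<le> y \<longleftrightarrow> x * (\<sim> y) \<le> - 1"
    and le_iff_uminus_mult: "x \<le> y \<longleftrightarrow> (- y) * x \<le> - 1"
begin

text \<open>The constant written 0 in the literature on involutive residuated lattices;
  it is not assumed to be the least element, nor to be absorbing, so the type class
  \<^class>\<open>zero\<close> is not used for it.\<close>

definition falsum :: 'a
  where "falsum = - 1"

text \<open>Meet and the two residuals are terms in these operations, so a subset closed under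
  them is also a subalgebra of the corresponding involutive residuated lattice.\<close>

definition subalgebra :: "'a set \<Rightarrow> bool"
  where "subalgebra S \<longleftrightarrow>
    1 \<in> S \<and>
    (\<forall>x\<in>S. \<forall>y\<in>S. sup x y \<in> S) \<and>
    (\<forall>x\<in>S. \<forall>y\<in>S. x * y \<in> S) \<and>
    (\<forall>x\<in>S. \<sim> x \<in> S) \<and>
    (\<forall>x\<in>S. - x \<in> S)"

end

end

theory Submission
  imports Defs
begin

text \<open>Instantiating the two residuation laws at \<open>- y * \<sim> z\<close> shows that the negations form an
  antitone Galois connection, and since the order determines \<open>x\<close> from \<open>\<sim> x\<close> and from \<open>- x\<close>, they
  are mutually inverse dual automorphisms of the order. They therefore exchange \<open>0\<close> and \<open>1\<close> and
  preserve the interval; the law \<open>x \<le> 1 \<longleftrightarrow> 0 x \<le> 0\<close> turns \<open>0 0 = 0\<close> into \<open>0 \<le> 1\<close>, and products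
  stay above \<open>0\<close> precisely because \<open>0 0 = 0\<close>.\<close>

context involutive_semiring
begin

lemma mult_mono_sup:
  assumes "x \<le> x'" "y \<le> y'"
  shows "x * y \<le> x' * y'"
proof -
  have "x * y \<le> x' * y"
    by (metis assms(1) le_iff_sup mult_sup_distrib_right)
  also have "\<dots> \<le> x' * y'"
    by (metis assms(2) le_iff_sup mult_sup_distrib_left)
  finally show ?thesis .
qed

lemma uminus_le_iff_tilde_le: "- y \<le> z \<longleftrightarrow> (\<sim> z) \<le> y"
  by (metis le_iff_mult_tilde le_iff_uminus_mult)

lemma tilde_antimono: "x \<le> y \<Longrightarrow> (\<sim> y) \<le> (\<sim> x)"
  by (metis order_refl order_trans uminus_le_iff_tilde_le)

lemma uminus_antimono: "x \<le> y \<Longrightarrow> - y \<le> - x"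
  by (metis order_refl order_trans uminus_le_iff_tilde_le)

lemma tilde_inject: "(\<sim> x) = (\<sim> y) \<Longrightarrow> x = y"
  by (metis order_antisym order_refl le_iff_mult_tilde)

lemma uminus_inject: "- x = - y \<Longrightarrow> x = y"
  by (metis order_antisym order_refl le_iff_uminus_mult)

text \<open>The Galois connection yields \<open>\<sim> (- (\<sim> x)) = \<sim> x\<close>, and
  injectivity cancels the outer \<open>\<sim>\<close>.\<close>

lemma uminus_tilde: "- (\<sim> x) = x"
proof (rule tilde_inject, rule order_antisym)
  show "(\<sim> (- (\<sim> x))) \<le> (\<sim> x)"
    using uminus_le_iff_tilde_le by blast
  show "(\<sim> x) \<le> (\<sim> (- (\<sim> x)))"
    by (simp add: tilde_antimono uminus_le_iff_tilde_le)
qed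

lemma tilde_uminus: "(\<sim> (- x)) = x"
  by (rule uminus_inject) (rule uminus_tilde)

lemma tilde_one: "(\<sim> 1) = falsum"
proof (rule order_antisym)
  show "(\<sim> 1) \<le> falsum"
    using le_iff_mult_tilde [of 1 1] by (simp add: falsum_def)
  show "falsum \<le> (\<sim> 1)"
    \<comment> \<open>Since \<open>- (\<sim> 1) = 1\<close>, the law reduces this to
      \<open>1 * falsum \<le> falsum\<close>.\<close>
    using le_iff_uminus_mult [of falsum "\<sim> 1"] by (simp add: uminus_tilde falsum_def)
qed

lemma tilde_falsum: "(\<sim> falsum) = 1"
  by (simp add: falsum_def tilde_uminus)

lemma uminus_falsum: "- falsum = 1"
  using uminus_tilde [of 1] by (simp add: tilde_one)

lemma le_one_iff: "x \<le> 1 \<longleftrightarrow> falsum * x \<le> falsum"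
  using le_iff_uminus_mult [of x 1] by (simp add: falsum_def)

lemma subalgebra_interval_iff:
  "subalgebra {falsum..1} \<longleftrightarrow> falsum * falsum = falsum"
proof
  assume sub: "subalgebra {falsum..1}"
  then have "falsum \<le> 1"
    by (simp add: subalgebra_def)
  with sub have "falsum \<le> falsum * falsum"
    by (simp add: subalgebra_def)
  \<comment> \<open>\<open>le_one_iff\<close> at \<open>falsum\<close> supplies the converse
    inequality.\<close>
  with \<open>falsum \<le> 1\<close> show "falsum * falsum = falsum"
    by (simp add: le_one_iff order_antisym)
next
  assume idem: "falsum * falsum = falsum"
  then have "falsum \<le> 1"
    by (simp add: le_one_iff)
  \<comment> \<open>By monotonicity the product lies between \<open>falsum * falsum\<close> and
    \<open>1 * 1\<close>.\<close>
  moreover have "falsum \<le> x * y \<and> x * y \<le> 1"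
    if "falsum \<le> x" "x \<le> 1" "falsum \<le> y" "y \<le> 1" for x y
    using mult_mono_sup [OF that(1,3)] mult_mono_sup [OF that(2,4)] idem by simp
  moreover have "falsum \<le> (\<sim> x) \<and> (\<sim> x) \<le> 1" if "falsum \<le> x" "x \<le> 1" for x
    using tilde_antimono [OF that(1)] tilde_antimono [OF that(2)]
    by (simp add: tilde_one tilde_falsum)
  moreover have "falsum \<le> - x \<and> - x \<le> 1" if "falsum \<le> x" "x \<le> 1" for x
    using uminus_antimono [OF that(1)] uminus_antimono [OF that(2)]
    by (simp add: falsum_def uminus_falsum [unfolded falsum_def])
  ultimately show "subalgebra {falsum..1}"
    by (simp add: subalgebra_def le_supI1)
qed

end

theorem theorem2:
  "subalgebra {(falsum :: 'a :: involutive_semiring)..1} \<longleftrightarrow>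
    (falsum :: 'a) * falsum = falsum"
  by (rule subalgebra_interval_iff)

end
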